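(* Let $q=p^k$ for some odd prime $p$ and some integer $k>0$. Let $Q,R,S$ be integers each of the form $p^i$ for some integer $i\ge 0$ (the exponents may differ). Let $r>0$ be an integer with $r\equiv Q+R+S\pmod{q+1}$. Let $f(X):=X^rB(X^{q-1})$, where one of the following holds: (1) $B(X):=X^{Q+R}+X^{Q+S}+X^{R+S}-1$ and $(Q,R,S)\equiv\pm(1,1,1)\pmod 4$; (2) $B(X):=X^{Q+R}-X^{Q+S}-X^{R+S}-1$ and $(Q,R,S)\equiv\pm(1,1,-1)\pmod 4$. Then $f(X)$ permutes $\mathbb{F}_{q^2}$ if and only if $\gcd(r,q-1)=1$ and one of the following holds: (i) $q\equiv 1\pmod 4$ and $\gcd(Q+R+S,q+1)=1$; (ii) $q\equiv -1\pmod 4$ and $\gcd(Q+R+S,q-1)=1$.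
   Context: A polynomial $f(X)\in\mathbb{F}_{q^2}[X]$ permutes $\mathbb{F}_{q^2}$ if the map $\alpha\mapsto f(\alpha)$ is a bijection of $\mathbb{F}_{q^2}$. For integers $\epsilon_1,\epsilon_2,\epsilon_3$, the notation $(Q,R,S)\equiv\pm(\epsilon_1,\epsilon_2,\epsilon_3)\pmod 4$ means that there is a single sign $s\in\{1,-1\}$ with $Q\equiv s\epsilon_1$, $R\equiv s\epsilon_2$, $S\equiv s\epsilon_3\pmod 4$. *)

theory Defs
  imports "HOL-Computational_Algebra.Polynomial" "HOL-Number_Theory.Cong" "HOL-Library.Cardinality"
begin

(* The sign s is common to all three congruences. *)
definition cong_upto_sign_mod4 :: "int \<times> int \<times> int \<Rightarrow> int \<times> int \<times> int \<Rightarrow> bool"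
  where "cong_upto_sign_mod4 u e \<longleftrightarrow>
    (case u of (Q, R, S) \<Rightarrow> case e of (e1, e2, e3) \<Rightarrow>
      \<exists>s\<in>{1, -1}. [Q = s * e1] (mod 4) \<and> [R = s * e2] (mod 4) \<and> [S = s * e3] (mod 4))"

definition permutes_field :: "'a::{field, finite} poly \<Rightarrow> bool"
  where "permutes_field f \<longleftrightarrow> bij (poly f)"

end

theory Submission
  imports Defs
begin

text \<open>
  Write \<open>N = Q + R + S\<close>, let \<open>U\<close> be the group of solutions of \<open>u ^ (q + 1) = 1\<close>, and let
  \<open>j\<close> be a square root of \<open>-1\<close>, which exists because \<open>4\<close> divides \<open>q\<^sup>2 - 1\<close>.

  Raising \<open>f x\<close> to the power \<open>q - 1\<close> gives \<open>g (x ^ (q - 1))\<close>, where \<open>g u = u ^ r * B u ^ (q - 1)\<close>,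
  and \<open>x \<mapsto> x ^ (q - 1)\<close> maps the nonzero elements onto \<open>U\<close>. So once \<open>B\<close> has no zero on \<open>U\<close>,
  \<open>f\<close> permutes the field iff \<open>gcd r (q - 1) = 1\<close> and \<open>g\<close> is injective on \<open>U\<close>
  (\<open>inj_power_times_power_iff\<close>).

  On \<open>U\<close>, raising to the power \<open>q\<close> is inversion, so \<open>B u ^ q\<close> is \<open>B\<close> evaluated at the inverse
  of \<open>u\<close>, and with \<open>e = \<plusminus>1\<close> according to the shape of \<open>B\<close>, \<open>g u\<close> becomes

    \<open>(u ^ S + e * u ^ R + e * u ^ Q - u ^ N) / (u ^ (Q + R) + e * u ^ (Q + S) + e * u ^ (R + S) - 1)\<close>.

  This is, up to sign, the expression of \<open>tan (\<alpha> + \<beta> + \<gamma>)\<close> through the tangents \<open>u ^ Q\<close>, \<open>u ^ R\<close>,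
  \<open>e * u ^ S\<close> of the three angles. The coordinate that turns addition of angles into multiplication is
  the Cayley transform \<open>\<phi> u = (1 + j * u) / (1 - j * u)\<close>. It satisfies
  \<open>\<phi> u ^ Q = \<phi> (\<plusminus> u ^ Q)\<close>, where the sign is the residue of \<open>Q\<close> modulo \<open>4\<close> because
  \<open>j ^ Q = \<plusminus> j\<close>. The congruences imposed on \<open>Q, R, S\<close> are exactly what makes the three signs
  fit together, so that \<open>\<phi> (g u) = \<phi> u ^ (\<plusminus> N)\<close>: in the coordinate \<open>\<phi>\<close> the map \<open>g\<close> is a power map
  (\<open>tangent_addition3\<close>). A zero of \<open>B\<close> on \<open>U\<close> would be a common zero of numerator and
  denominator, hence of \<open>(1 + j * u) ^ N\<close> and \<open>(1 - j * u) ^ N\<close>, which is absurd.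

  It remains to see where \<open>\<phi>\<close> sends \<open>U\<close>. If \<open>q \<equiv> 1\<close> modulo \<open>4\<close>, then \<open>j ^ q = j\<close> and the image is
  the coset \<open>w ^ (q + 1) = -1\<close> of the roots of unity of order dividing \<open>q + 1\<close>; if \<open>q \<equiv> -1\<close>, then
  \<open>j ^ q = - j\<close> and the image is the coset \<open>w ^ (q - 1) = -1\<close> together with \<open>0\<close> and \<open>\<infinity>\<close>. The
  \<open>N\<close>-th power map is injective there iff \<open>N\<close> is coprime to \<open>q + 1\<close>, respectively \<open>q - 1\<close>
  (\<open>inj_on_cayley_power_iff\<close>).
\<close>

section \<open>Roots of unity in finite fields\<close>

lemma finite_field_power_card_minus_1:
  fixes x :: "'a::{field,finite}"
  assumes "x \<noteq> 0"
  shows "x ^ (CARD('a) - 1) = 1"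
proof -
  have "(\<Prod>y\<in>UNIV-{0}. x * y) = (\<Prod>y\<in>UNIV-{0}. y)"
    by (rule prod.reindex_bij_witness[of _ "\<lambda>y. y / x" "\<lambda>y. x * y"]) (use assms in auto)
  then have "x ^ (CARD('a) - 1) * \<Prod>(UNIV - {0::'a}) = \<Prod>(UNIV - {0})"
    by (simp add: prod.distrib card_Diff_singleton)
  moreover have "\<Prod>(UNIV - {0::'a}) \<noteq> 0"
    by simp
  ultimately show ?thesis
    by simp
qed

lemma power_eq_1_if_dvd:
  fixes x :: "'a::monoid_mult"
  assumes "x ^ d = 1" "d dvd n"
  shows "x ^ n = 1"
  using assms by (auto elim!: dvdE simp: power_mult)

lemma power_eq_1_gcd:
  fixes x :: "'a::field"
  assumes "x ^ a = 1" "x ^ b = 1" "gcd a b = 1"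
  shows "x = 1"
proof (cases "a = 0")
  case True
  then show ?thesis using assms by simp
next
  case False
  then obtain u v where "a * u = b * v + gcd a b"
    using bezout_nat by blast
  then have "x ^ (a * u) = x ^ (b * v) * x"
    using assms(3) by simp
  then show ?thesis
    using assms by (simp add: power_mult)
qed

text \<open>
  A polynomial of degree \<open>m\<close> has too few roots to vanish on all nonzero elements. This counting
  replaces a generator of the multiplicative group in all existence statements below.
\<close>
lemma exists_power_neq_1:
  assumes "m > 0" "m < CARD('a) - 1"
  shows "\<exists>x::'a::{field,finite}. x \<noteq> 0 \<and> x ^ m \<noteq> 1"
proof (rule ccontr)
  assume "\<not> ?thesis"
  then have sub: "UNIV - {0::'a} \<subseteq> {x. poly (monom 1 m - 1) x = 0}"
    by (auto simp: poly_monom)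
  have "coeff (monom 1 m - 1 :: 'a poly) m = 1"
    using assms(1) by simp
  then have nz: "(monom 1 m - 1 :: 'a poly) \<noteq> 0"
    by (metis coeff_0 one_neq_zero)
  have "CARD('a) - 1 = card (UNIV - {0::'a})"
    by (simp add: card_Diff_singleton)
  also have "\<dots> \<le> card {x::'a. poly (monom 1 m - 1) x = 0}"
    by (rule card_mono[OF _ sub]) simp
  also have "\<dots> \<le> degree (monom 1 m - 1 :: 'a poly)"
    by (rule card_poly_roots_bound[OF nz])
  also have "\<dots> \<le> m"
    by (rule degree_diff_le) (simp_all add: degree_monom_le)
  finally show False
    using assms(2) by simp
qed

lemma exists_nontrivial_root_of_unity:
  assumes "d dvd CARD('a) - 1" "d > 1" "CARD('a) > 1"
  shows "\<exists>z::'a::{field,finite}. z \<noteq> 1 \<and> z ^ d = 1"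
proof -
  obtain m where m: "CARD('a) - 1 = m * d"
    using assms(1) by (metis dvd_def mult.commute)
  with assms(3) have "m > 0" by (cases m) auto
  moreover have "m < CARD('a) - 1"
    using m assms(2) \<open>m > 0\<close> by simp
  ultimately obtain x :: 'a where x: "x \<noteq> 0" "x ^ m \<noteq> 1"
    using exists_power_neq_1 by blast
  have "(x ^ m) ^ d = 1"
    using finite_field_power_card_minus_1[OF x(1)] m by (simp add: power_mult)
  with x(2) show ?thesis by blast
qed

lemma exists_sqrt_minus_1:
  assumes "4 dvd CARD('a) - 1" "CARD('a) > 1"
  shows "\<exists>j::'a::{field,finite}. j\<^sup>2 = -1"
proof -
  obtain m where m: "CARD('a) - 1 = 4 * m"
    using assms(1) by (metis dvd_def)
  with assms(2) have "m > 0" by (cases m) auto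
  then obtain x :: 'a where x: "x \<noteq> 0" "x ^ (2 * m) \<noteq> 1"
    using exists_power_neq_1[where 'a='a, of "2 * m"] m by auto
  have "(x ^ (2 * m))\<^sup>2 = 1"
    using finite_field_power_card_minus_1[OF x(1)] m
    by (simp flip: power_mult add: mult.commute)
  then have "x ^ (2 * m) = -1"
    using x(2) by (simp add: power2_eq_1_iff)
  then have "(x ^ m)\<^sup>2 = -1"
    by (simp flip: power_mult add: mult.commute)
  then show ?thesis by blast
qed

lemma sqrt_minus_1_power:
  fixes j :: "'a::comm_ring_1"
  assumes "j\<^sup>2 = -1"
  shows "n mod 4 = 1 \<Longrightarrow> j ^ n = j" and "n mod 4 = 3 \<Longrightarrow> j ^ n = - j"
proof -
  have j4: "j ^ 4 = 1"
    using power_mult[of j 2 2] assms by simp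
  have "j ^ n = j ^ (n mod 4)"
    using power_add[of j "4 * (n div 4)" "n mod 4"] by (simp add: power_mult j4)
  moreover have "j ^ 3 = -j"
    using assms by (simp add: power3_eq_cube power2_eq_square)
  ultimately show "n mod 4 = 1 \<Longrightarrow> j ^ n = j" "n mod 4 = 3 \<Longrightarrow> j ^ n = - j"
    by simp_all
qed

section \<open>The Frobenius endomorphism\<close>

text \<open>
  Translation by \<open>1\<close> permutes the field, so it preserves the sum of all elements; hence the
  characteristic divides the number of elements.
\<close>
lemma CHAR_eq_prime_if_CARD_eq_power:
  assumes "prime p" "CARD('a::{field,finite}) = p ^ n"
  shows "CHAR('a) = p"
proof -
  have pr: "prime CHAR('a)"
    by (rule prime_CHAR_semidom, rule finite_imp_CHAR_pos) simp
  moreover have "(\<Sum>x::'a\<in>UNIV. x + 1) = (\<Sum>x\<in>UNIV. x)"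
    by (rule sum.reindex_bij_witness[of _ "\<lambda>x. x - 1" "\<lambda>x. x + 1"]) auto
  then have "of_nat CARD('a) = (0::'a)"
    by (simp add: sum.distrib)
  then have "CHAR('a) dvd p ^ n"
    by (simp only: of_nat_eq_0_iff_char_dvd assms(2))
  ultimately show ?thesis
    using assms(1) by (meson prime_dvd_power primes_dvd_imp_eq)
qed

lemma frobenius_add:
  fixes x y :: "'a::{field,finite}"
  assumes "prime p" "CARD('a) = p ^ n"
  shows "(x + y) ^ (p ^ i) = x ^ (p ^ i) + y ^ (p ^ i)"
  using CHAR_eq_prime_if_CARD_eq_power[OF assms] assms(1) by (intro freshmans_dream') auto

lemma frobenius_diff:
  fixes x y :: "'a::{field,finite}"
  assumes "prime p" "CARD('a) = p ^ n"
  shows "(x - y) ^ (p ^ i) = x ^ (p ^ i) - y ^ (p ^ i)"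
  using frobenius_add[OF assms, of "x - y" y i] by (simp add: eq_diff_eq)

lemma two_neq_0_if_CARD_odd_prime_power:
  assumes "prime p" "odd p" "CARD('a::{field,finite}) = p ^ n"
  shows "(2::'a) \<noteq> 0"
proof
  assume "(2::'a) = 0"
  then have "of_nat 2 = (0::'a)" by simp
  then have "p dvd 2"
    unfolding of_nat_eq_0_iff_char_dvd
    using CHAR_eq_prime_if_CARD_eq_power[OF assms(1,3)] by simp
  with assms(1,2) show False
    by (metis primes_dvd_imp_eq two_is_prime_nat dvd_refl)
qed

section \<open>Reduction to the roots of unity of order dividing \<open>q + 1\<close>\<close>

text \<open>
  Elements of norm \<open>1\<close> over the subfield with \<open>q\<close> elements are quotients of conjugates. The usual
  resolvent \<open>y = t + t ^ q / u\<close> satisfies \<open>y ^ q = u * y\<close>; it is nonzero for \<open>t = 1\<close> unless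
  \<open>u = -1\<close>, and then any \<open>t\<close> outside the subfield works.
\<close>
lemma hilbert90_finite_field:
  fixes u :: "'a::{field,finite}"
  assumes "prime p" "q = p ^ k" "CARD('a) = q\<^sup>2" "q > 1" "u ^ (q + 1) = 1"
  shows "\<exists>y. y \<noteq> 0 \<and> y ^ (q - 1) = u"
proof -
  have card: "CARD('a) = p ^ (2 * k)"
    using assms(2,3) by (simp add: power_mult[symmetric] mult.commute)
  note frob = frobenius_add[OF assms(1) card, of _ _ k, folded assms(2)]
    frobenius_diff[OF assms(1) card, of _ _ k, folded assms(2)]
  have u0: "u \<noteq> 0" using assms(5) by (cases "u = 0") auto
  have qq: "t ^ q ^ 2 = t" for t :: 'a
  proof (cases "t = 0")
    case False
    have "t ^ q ^ 2 = t ^ (q ^ 2 - 1) * t"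
      using assms(4) by (metis power_minus_mult zero_less_power zero_less_one less_trans)
    then show ?thesis
      using finite_field_power_card_minus_1[OF False] assms(3) by simp
  qed (use assms(4) in simp)
  have "\<exists>y. y \<noteq> 0 \<and> y ^ q = u * y"
  proof (cases "u = -1")
    case False
    have "u * (1 + u ^ q) = u + 1"
      using assms(5) by (simp add: distrib_left)
    with False have "1 + u ^ q \<noteq> 0"
      by (metis add_eq_0_iff mult_zero_right add.commute)
    moreover have "(1 + u ^ q) ^ q = 1 + u"
      using qq[of u] by (simp add: frob power2_eq_square power_mult)
    ultimately show ?thesis
      using \<open>u * (1 + u ^ q) = u + 1\<close> by (metis add.commute)
  next
    case True
    have "q - 1 < q\<^sup>2 - 1"
      using assms(4) by (simp add: power2_eq_square diff_less_mono)
    then obtain t :: 'a where t: "t \<noteq> 0" "t ^ (q - 1) \<noteq> 1"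
      using exists_power_neq_1[where 'a='a, of "q - 1"] assms(3,4) by auto
    have "t ^ q \<noteq> t"
      using t assms(4) by (metis power_minus_mult less_trans zero_less_one mult_cancel_right1)
    then have "t - t ^ q \<noteq> 0" by auto
    moreover have "(t - t ^ q) ^ q = u * (t - t ^ q)"
      using qq[of t] True by (simp add: frob power2_eq_square power_mult)
    ultimately show ?thesis by blast
  qed
  then obtain y where y: "y \<noteq> 0" "y ^ q = u * y" by blast
  have "y ^ (q - 1) * y = y ^ q"
    using assms(4) by (intro power_minus_mult) simp
  with y show ?thesis by auto
qed

text \<open>
  The map \<open>x \<mapsto> x ^ (q - 1)\<close> semiconjugates \<open>x ^ r * h (x ^ (q - 1))\<close> to \<open>u ^ r * h u ^ (q - 1)\<close> on
  the solutions of \<open>u ^ (q + 1) = 1\<close>. Its fibres among the nonzero elements are the cosets of the group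
  \<open>c ^ (q - 1) = 1\<close>, and on a fibre the first map acts as \<open>c \<mapsto> c ^ r\<close> up to a nonzero factor; so
  injectivity splits into injectivity on the quotient and coprimality of \<open>r\<close> and \<open>q - 1\<close>.
\<close>
lemma inj_power_times_power_iff:
  fixes h :: "'a::{field,finite} \<Rightarrow> 'a"
  assumes "prime p" "q = p ^ k" "CARD('a) = q\<^sup>2" "q > 1" "r > 0"
    and h: "\<And>u. u ^ (q + 1) = 1 \<Longrightarrow> h u \<noteq> 0"
  shows "inj (\<lambda>x. x ^ r * h (x ^ (q - 1))) \<longleftrightarrow>
    gcd r (q - 1) = 1 \<and> inj_on (\<lambda>u. u ^ r * h u ^ (q - 1)) {u. u ^ (q + 1) = 1}"
    (is "inj ?f \<longleftrightarrow> _ \<and> inj_on ?g ?U")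
proof -
  have q1: "q\<^sup>2 - 1 = (q - 1) * (q + 1)"
    by (simp add: algebra_simps power2_eq_square)
  have U: "x ^ (q - 1) \<in> ?U" if "x \<noteq> 0" for x :: 'a
    using finite_field_power_card_minus_1[OF that]
    unfolding assms(3) q1 mem_Collect_eq power_mult .
  have fg: "?f x ^ (q - 1) = ?g (x ^ (q - 1))" for x
    by (simp add: power_mult_distrib power_mult[symmetric] mult.commute)
  have f0: "?f x = 0 \<longleftrightarrow> x = 0" for x
    using h U assms(5) by auto
  show ?thesis
  proof (intro iffI conjI)
    assume "gcd r (q - 1) = 1 \<and> inj_on ?g ?U"
    then have gcd: "gcd r (q - 1) = 1" and inj: "inj_on ?g ?U" by auto
    show "inj ?f"
    proof (rule injI)
      fix x y assume eq: "?f x = ?f y"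
      show "x = y"
      proof (cases "x = 0 \<or> y = 0")
        case True
        then show ?thesis using eq f0 by metis
      next
        case False
        then have "x ^ (q - 1) = y ^ (q - 1)"
          using inj_onD[OF inj, of "x ^ (q - 1)" "y ^ (q - 1)"] eq fg[of x] fg[of y] U by metis
        moreover from this have "x ^ r = y ^ r"
          using eq h[of "y ^ (q - 1)"] U[of y] False by simp
        ultimately have "x / y = 1"
          using False power_eq_1_gcd[of "x / y", OF _ _ gcd] by (simp add: power_divide)
        then show ?thesis using False by simp
      qed
    qed
  next
    assume inj: "inj ?f"
    show gcd: "gcd r (q - 1) = 1"
    proof (rule ccontr)
      let ?d = "gcd r (q - 1)"
      assume "?d \<noteq> 1"
      then have "?d > 1"
        using assms(5) by (simp add: nat_neq_iff)
      moreover have "?d dvd CARD('a) - 1"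
        unfolding assms(3) q1 by (intro dvd_mult2 gcd_dvd2)
      moreover have "CARD('a) > 1"
        using one_less_power[OF assms(4), of 2] assms(3) by simp
      ultimately obtain z :: 'a where z: "z \<noteq> 1" "z ^ ?d = 1"
        using exists_nontrivial_root_of_unity by blast
      have "z ^ r = 1" "z ^ (q - 1) = 1"
        using z(2) power_eq_1_if_dvd by (meson gcd_dvd1 gcd_dvd2)+
      then have "?f z = ?f 1" by simp
      with inj have "z = 1" by (rule injD)
      with z(1) show False ..
    qed
    show "inj_on ?g ?U"
    proof (rule inj_onI)
      fix u v assume uv: "u \<in> ?U" "v \<in> ?U" and eq: "?g u = ?g v"
      obtain x where x: "x \<noteq> 0" "x ^ (q - 1) = u"
        using hilbert90_finite_field[OF assms(1-4)] uv(1) by blast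
      obtain y where y: "y \<noteq> 0" "y ^ (q - 1) = v"
        using hilbert90_finite_field[OF assms(1-4)] uv(2) by blast
      define c where "c = ?f y / ?f x"
      have "?f y ^ (q - 1) = ?f x ^ (q - 1)"
        using fg[of x] fg[of y] eq unfolding x(2) y(2) by (simp only:)
      moreover have "?f x ^ (q - 1) \<noteq> 0"
        using f0[of x] x(1) by (metis power_not_zero)
      ultimately have c1: "c ^ (q - 1) = 1"
        unfolding c_def power_divide by (metis divide_self)
      \<comment> \<open>As \<open>r\<close> is invertible modulo \<open>q - 1\<close>, the factor \<open>c\<close> is an \<open>r\<close>-th power inside the fibre, so
        \<open>x\<close> can be moved within its fibre to have the same image as \<open>y\<close>.\<close>
      obtain a b where ab: "r * a = (q - 1) * b + 1"
        using bezout_nat[of r "q - 1"] assms(5) gcd by auto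
      have "(c ^ a) ^ r = c ^ ((q - 1) * b + 1)"
        by (metis ab power_mult mult.commute)
      also have "\<dots> = c"
        using c1 by (simp add: power_mult)
      finally have ca: "(c ^ a) ^ r = c" .
      have ca1: "(c ^ a) ^ (q - 1) = 1"
        using c1 by (metis power_mult mult.commute power_one)
      have "?f (c ^ a * x) = c * ?f x"
        using ca ca1 by (simp add: power_mult_distrib)
      also have "\<dots> = ?f y"
        using f0[of x] x(1) by (simp add: c_def)
      finally have "c ^ a * x = y"
        by (rule injD[OF inj])
      then show "u = v"
        using x y ca1 by (metis power_mult_distrib mult_1)
    qed
  qed
qed

section \<open>Power maps in the Cayley coordinate\<close>

text \<open>
  The two assumptions on \<open>g\<close> say that \<open>(1 + i * g x) / (1 - i * g x)\<close> is the \<open>N\<close>-th power of the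
  Cayley transform \<open>(1 + j * x) / (1 - j * x)\<close>. Treating numerator and denominator separately avoids
  the point at infinity, which is reached when \<open>j * x = 1\<close>. Two points \<open>x, y\<close> are compared through
  \<open>W / V\<close>, the quotient of their Cayley transforms: \<open>x = y\<close> means \<open>W = V\<close>, and \<open>g x = g y\<close> means
  \<open>W ^ N = V ^ N\<close>. Since the Frobenius map inverts the solutions of \<open>x ^ (q + 1) = 1\<close>, it sends
  \<open>W / V\<close> to its inverse if \<open>j ^ q = j\<close> and fixes it if \<open>j ^ q = - j\<close>, which makes it an \<open>m\<close>-th root
  of unity. Conversely every \<open>m\<close>-th root of unity \<open>z\<close> is such a quotient, with \<open>y = 1\<close>.
\<close>
lemma inj_on_cayley_power_iff:
  fixes j :: "'a::{field,finite}" and g b :: "'a \<Rightarrow> 'a"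
  assumes "prime p" "odd p" "q = p ^ k" "CARD('a) = q\<^sup>2" "q > 1" "N > 0"
    and j: "j\<^sup>2 = -1" and i: "i \<noteq> 0"
    and m: "j ^ q = j \<and> m = q + 1 \<or> j ^ q = - j \<and> m = q - 1"
    and b: "\<And>x. x ^ (q + 1) = 1 \<Longrightarrow> b x \<noteq> 0"
    and g: "\<And>x. x ^ (q + 1) = 1 \<Longrightarrow> (1 + j * x) ^ N = b x * (1 + i * g x)"
      "\<And>x. x ^ (q + 1) = 1 \<Longrightarrow> (1 - j * x) ^ N = b x * (1 - i * g x)"
  shows "inj_on g {x. x ^ (q + 1) = 1} \<longleftrightarrow> gcd N m = 1"
    (is "inj_on g ?U \<longleftrightarrow> _")
proof -
  have card: "CARD('a) = p ^ (2 * k)"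
    using assms(3,4) by (simp add: power_mult[symmetric] mult.commute)
  note frob = frobenius_add[OF assms(1) card, of _ _ k, folded assms(3)]
    frobenius_diff[OF assms(1) card, of _ _ k, folded assms(3)]
  have two: "(2::'a) \<noteq> 0"
    by (rule two_neq_0_if_CARD_odd_prime_power[OF assms(1,2) card])
  have jj: "j * j = -1" using j by (simp add: power2_eq_square)
  have q0: "q > 0" using assms(5) by simp
  define W where "W x y = (1 + j * x) * (1 - j * y)" for x y
  define V where "V x y = (1 - j * x) * (1 + j * y)" for x y
  have WV: "W x y = V x y \<longleftrightarrow> x = y" for x y
  proof -
    have "W x y - V x y = 2 * j * (x - y)"
      by (simp add: W_def V_def algebra_simps)
    moreover have "j \<noteq> 0" using j by auto
    ultimately show ?thesis using two by auto
  qed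
  have gWV: "g x = g y \<longleftrightarrow> W x y ^ N = V x y ^ N" if "x \<in> ?U" "y \<in> ?U" for x y
  proof -
    have "W x y ^ N - V x y ^ N = 2 * i * b x * b y * (g x - g y)"
      using that by (simp add: W_def V_def power_mult_distrib g) (simp add: algebra_simps)
    then show ?thesis using two i b that by auto
  qed
  have frobU: "(1 + j * x) ^ q * x = x + j ^ q" "(1 - j * x) ^ q * x = x - j ^ q"
    if "x \<in> ?U" for x
    using that by (simp_all add: frob power_mult_distrib algebra_simps)
  show ?thesis
  proof
    assume gcd: "gcd N m = 1"
    show "inj_on g ?U"
    proof (rule inj_onI)
      fix x y assume xy: "x \<in> ?U" "y \<in> ?U" and eq: "g x = g y"
      have x0: "x \<noteq> 0" "y \<noteq> 0" using xy by auto
      have eqN: "W x y ^ N = V x y ^ N"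
        using eq gWV xy by simp
      show "x = y"
      proof (cases "V x y = 0")
        case True
        then have "W x y = 0" using eqN assms(6) by (metis power_eq_0_iff)
        with True show ?thesis using WV[of x y] by simp
      next
        case False
        then have W0: "W x y \<noteq> 0" using eqN assms(6) by (metis power_eq_0_iff)
        define z where "z = W x y / V x y"
        have zN: "z ^ N = 1"
          using eqN False by (simp add: z_def power_divide)
        have "z ^ m = 1"
        proof (rule disjE[OF m])
          assume A: "j ^ q = j \<and> m = q + 1"
          have "W x y ^ q * (x * y) = ((1 + j * x) ^ q * x) * ((1 - j * y) ^ q * y)"
            by (simp add: W_def power_mult_distrib mult_ac)
          also have "\<dots> = (x + j) * (y - j)"
            using frobU xy A by simp
          also have "\<dots> = V x y"
            using jj unfolding V_def by algebra
          finally have 1: "W x y ^ q * (x * y) = V x y" .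
          have "V x y ^ q * (x * y) = ((1 - j * x) ^ q * x) * ((1 + j * y) ^ q * y)"
            by (simp add: V_def power_mult_distrib mult_ac)
          also have "\<dots> = (x - j) * (y + j)"
            using frobU xy A by simp
          also have "\<dots> = W x y"
            using jj unfolding W_def by algebra
          finally have 2: "V x y ^ q * (x * y) = W x y" .
          have "z ^ q = (W x y ^ q * (x * y)) / (V x y ^ q * (x * y))"
            using x0 by (simp add: z_def power_divide)
          also have "\<dots> = V x y / W x y"
            by (simp only: 1 2)
          finally show ?thesis
            using A W0 False by (simp add: z_def)
        next
          assume A: "j ^ q = -j \<and> m = q - 1"
          have "W x y ^ q * (x * y) = ((1 + j * x) ^ q * x) * ((1 - j * y) ^ q * y)"
            by (simp add: W_def power_mult_distrib mult_ac)
          also have "\<dots> = (x - j) * (y + j)"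
            using frobU xy A by simp
          also have "\<dots> = W x y"
            using jj unfolding W_def by algebra
          finally have 1: "W x y ^ q * (x * y) = W x y" .
          have "V x y ^ q * (x * y) = ((1 - j * x) ^ q * x) * ((1 + j * y) ^ q * y)"
            by (simp add: V_def power_mult_distrib mult_ac)
          also have "\<dots> = (x + j) * (y - j)"
            using frobU xy A by simp
          also have "\<dots> = V x y"
            using jj unfolding V_def by algebra
          finally have 2: "V x y ^ q * (x * y) = V x y" .
          have "z ^ q = (W x y ^ q * (x * y)) / (V x y ^ q * (x * y))"
            using x0 by (simp add: z_def power_divide)
          also have "\<dots> = z"
            by (simp only: 1 2 z_def)
          finally have "z ^ (q - 1) * z = z"
            by (simp only: power_minus_mult[OF q0])
          then show ?thesis
            using A W0 False by (simp add: z_def)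
        qed
        then have "z = 1"
          using power_eq_1_gcd[OF zN _ gcd] by blast
        then show ?thesis
          using WV False by (simp add: z_def)
      qed
    qed
  next
    assume inj: "inj_on g ?U"
    show "gcd N m = 1"
    proof (rule ccontr)
      let ?d = "gcd N m"
      assume "?d \<noteq> 1"
      then have "?d > 1"
        using assms(6) by (simp add: nat_neq_iff)
      moreover have "CARD('a) - 1 = (q - 1) * (q + 1)"
        using assms(4) by (simp add: algebra_simps power2_eq_square)
      then have "m dvd CARD('a) - 1" using m by (metis dvd_triv_left dvd_triv_right)
      then have "?d dvd CARD('a) - 1" by (meson dvd_trans gcd_dvd2)
      moreover have "CARD('a) > 1"
        using one_less_power[OF assms(5), of 2] assms(4) by simp
      ultimately obtain z :: 'a where z: "z \<noteq> 1" "z ^ ?d = 1"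
        using exists_nontrivial_root_of_unity by blast
      have zN: "z ^ N = 1"
        using power_eq_1_if_dvd[OF z(2) gcd_dvd1] .
      have zm: "z ^ m = 1"
        using power_eq_1_if_dvd[OF z(2) gcd_dvd2] .
      have z0: "z \<noteq> 0" using zN assms(6) by (auto simp: power_0_left)
      have zj: "z \<noteq> j" "z \<noteq> -j"
      proof -
        have odd: "odd q" using assms(2,3) by simp
        have "j ^ m = -1 \<and> (-j) ^ m = -1"
          using m
        proof
          assume "j ^ q = j \<and> m = q + 1"
          then show ?thesis using odd jj by simp
        next
          assume A: "j ^ q = -j \<and> m = q - 1"
          then have "j ^ (q - 1) * j = -1 * j"
            using power_minus_mult[OF q0, of j] by simp
          moreover have "j \<noteq> 0" using j by auto
          ultimately have "j ^ (q - 1) = -1" by (metis mult_right_cancel)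
          then show ?thesis using A odd by simp
        qed
        moreover have "(-1::'a) \<noteq> 1"
          using two by (metis add.right_inverse one_add_one)
        ultimately show "z \<noteq> j" "z \<noteq> -j"
          using zm by auto
      qed
      \<comment> \<open>The Cayley transform of \<open>1\<close> is \<open>j\<close>; this \<open>x\<close> is the point whose Cayley transform is \<open>z * j\<close>.\<close>
      define x where "x = (z * j - 1) / (j - z)"
      have jz: "j - z \<noteq> 0" "j + z \<noteq> 0"
        using zj by (auto simp: add_eq_0_iff)
      have xz: "x * (j - z) = z * j - 1"
        using jz by (simp add: x_def)
      have WVx: "W x 1 = z * V x 1"
      proof -
        have "(W x 1 - z * V x 1) * (j - z) = 0"
          using xz jj unfolding W_def V_def by algebra
        then show ?thesis using jz by simp
      qed
      have xU: "x \<in> ?U"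
        using m
      proof
        assume A: "j ^ q = j \<and> m = q + 1"
        have zq: "z ^ q * z = 1" using zm A by (simp add: mult.commute)
        have "x ^ q * (j - z ^ q) = z ^ q * j - 1"
          using arg_cong[OF xz, of "\<lambda>t. t ^ q"] A by (simp add: frob power_mult_distrib)
        moreover have "(X * x - 1) * (j - z) = 0"
          if "X * (j - Z) = Z * j - 1" "Z * z = 1" for X Z
        proof -
          have "X * (z * j - 1) = j - z"
            using that by algebra
          then show ?thesis
            using xz by algebra
        qed
        ultimately have "(x ^ q * x - 1) * (j - z) = 0"
          using zq by blast
        then show ?thesis using jz by (simp add: mult.commute)
      next
        assume A: "j ^ q = -j \<and> m = q - 1"
        have zq: "z ^ q = z"
          using zm A q0 by (metis mult_1 power_minus_mult)
        have "x ^ q * (- j - z) = - (z * j) - 1"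
          using arg_cong[OF xz, of "\<lambda>t. t ^ q"] A zq by (simp add: frob power_mult_distrib)
        moreover have "(X * x - 1) * ((j + z) * (j - z)) = 0" if "X * (- j - z) = - (z * j) - 1" for X
          using that xz jj by algebra
        ultimately have "(x ^ q * x - 1) * ((j + z) * (j - z)) = 0"
          by blast
        then show ?thesis using jz by (simp add: mult.commute)
      qed
      have "g x = g 1"
        using gWV[OF xU, of 1] WVx zN by (simp add: power_mult_distrib)
      then have "x = 1"
        using inj xU by (auto dest: inj_onD)
      then have "W x 1 = V x 1" using WV by simp
      with WVx z(1) have "V x 1 = 0" by auto
      with \<open>x = 1\<close> have "(1 - j) * (1 + j) = 0" by (simp add: V_def)
      moreover have "(1 - j) * (1 + j) = 2" using jj by (simp add: algebra_simps)
      ultimately show False using two by simp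
    qed
  qed
qed

section \<open>The tangent addition formula\<close>

text \<open>
  The real case \<open>s = e = 1\<close> expands \<open>(1 + j * tan \<alpha>) * (1 + j * tan \<beta>) * (1 + j * tan \<gamma>)\<close> into real
  and imaginary part, whose quotient is \<open>tan (\<alpha> + \<beta> + \<gamma>)\<close>. The sign \<open>s\<close> stands for the common sign
  of the congruences modulo \<open>4\<close>, and \<open>e\<close> distinguishes the two shapes of \<open>B\<close>.
\<close>
lemma tangent_addition3:
  fixes j s e a b c :: "'a::comm_ring_1"
  assumes "j\<^sup>2 = -1" "s\<^sup>2 = 1" "e\<^sup>2 = 1"
  shows "(1 + s * j * a) * (1 + s * j * b) * (1 + s * e * j * c) =
    - (a * b + e * (a * c) + e * (b * c) - 1) + s * e * j * (e * a + e * b + c - a * b * c)"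
proof -
  have "(s * j) * (s * j) = s\<^sup>2 * j\<^sup>2" "s * e * j * e = s * j * e\<^sup>2"
    by (simp_all add: power2_eq_square mult_ac)
  then have sj: "(s * j) * (s * j) = -1" and se: "s * e * j * e = s * j"
    using assms by simp_all
  have "(s * j) * (s * e * j) = ((s * j) * (s * j)) * e"
    by (simp add: mult_ac)
  with sj have sej: "(s * j) * (s * e * j) = - e"
    by simp
  have "(1 + s * j * a) * (1 + s * j * b) * (1 + s * e * j * c) =
      1 + (s * j) * (a + b) + s * e * j * c + ((s * j) * (s * j)) * (a * b)
      + ((s * j) * (s * e * j)) * ((a + b) * c) + ((s * j) * (s * j)) * (s * e * j) * (a * b * c)"
    by (simp add: algebra_simps)
  also have "\<dots> = - (a * b + e * (a * c) + e * (b * c) - 1)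
      + (s * e * j * e * (a + b) + s * e * j * c - s * e * j * (a * b * c))"
    unfolding sj sej se by (simp add: algebra_simps)
  finally show ?thesis
    by (simp add: algebra_simps)
qed

theorem corollary1p8:
  fixes p k q Q R S r :: nat
    and B f :: "'a::{field, finite} poly"
  assumes "prime p" and "odd p" and "k > 0" and "q = p ^ k"
    and "CARD('a) = q\<^sup>2"
    and "\<exists>i. Q = p ^ i" and "\<exists>i. R = p ^ i" and "\<exists>i. S = p ^ i"
    and "r > 0" and "[r = Q + R + S] (mod (q + 1))"
    and "(B = monom 1 (Q + R) + monom 1 (Q + S) + monom 1 (R + S) - 1
            \<and> cong_upto_sign_mod4 (int Q, int R, int S) (1, 1, 1))
       \<or> (B = monom 1 (Q + R) - monom 1 (Q + S) - monom 1 (R + S) - 1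
            \<and> cong_upto_sign_mod4 (int Q, int R, int S) (1, 1, -1))"
    and "f = monom 1 r * pcompose B (monom 1 (q - 1))"
  shows "permutes_field f \<longleftrightarrow>
    gcd r (q - 1) = 1 \<and>
      (([int q = 1] (mod 4) \<and> gcd (Q + R + S) (q + 1) = 1)
       \<or> ([int q = -1] (mod 4) \<and> gcd (Q + R + S) (q - 1) = 1))"
proof -
  let ?N = "Q + R + S"
  have card: "CARD('a) = p ^ (2 * k)"
    using assms(4,5) by (simp add: power_mult[symmetric] mult.commute)
  have q1: "q > 1"
    unfolding assms(4) using prime_gt_1_nat[OF assms(1)] assms(3) by (rule one_less_power)
  have odd: "odd q" using assms(2,4) by simp
  note frob = frobenius_add[OF assms(1) card] frobenius_diff[OF assms(1) card]
  have frobq: "(x + y) ^ q = x ^ q + y ^ q" "(x - y) ^ q = x ^ q - y ^ q" for x y :: 'a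
    unfolding assms(4) by (rule frob)+
  have two: "(2::'a) \<noteq> 0"
    by (rule two_neq_0_if_CARD_odd_prime_power[OF assms(1,2) card])
  have frobQ: "(1 + x) ^ Q = 1 + x ^ Q" "(1 + x) ^ R = 1 + x ^ R" "(1 + x) ^ S = 1 + x ^ S"
    for x :: 'a
    using assms(6-8) frob(1)[of 1 x] by auto
  have N0: "?N > 0"
    using assms(6) prime_gt_0_nat[OF assms(1)] by auto
  have "4 dvd (q - 1) * (q + 1)"
    using odd by (elim oddE) simp
  then have "4 dvd CARD('a) - 1"
    using assms(5) by (simp add: algebra_simps power2_eq_square)
  then obtain j :: 'a where j: "j\<^sup>2 = -1"
    using exists_sqrt_minus_1 assms(5) q1 by (metis one_less_power pos2)
  have neg: "(-1::'a) \<noteq> 1"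
    using two by (metis add.right_inverse one_add_one)
  obtain e :: 'a where e: "e = 1 \<or> e = -1"
      and B: "\<And>x. poly B x = x ^ Q * x ^ R + e * (x ^ Q * x ^ S) + e * (x ^ R * x ^ S) - 1"
      and cong: "cong_upto_sign_mod4 (int Q, int R, int S) (1, 1, if e = 1 then 1 else -1)"
  proof -
    from assms(11) show thesis
      using that[of 1] that[of "-1"] neg by (auto simp: poly_monom power_add)
  qed
  have mod4: "[int n = 1] (mod 4) \<longleftrightarrow> n mod 4 = 1" "[int n = -1] (mod 4) \<longleftrightarrow> n mod 4 = 3"
    for n :: nat
  proof -
    have "int n mod 4 = int (n mod 4)" by (simp add: zmod_int)
    then show "[int n = 1] (mod 4) \<longleftrightarrow> n mod 4 = 1" "[int n = -1] (mod 4) \<longleftrightarrow> n mod 4 = 3"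
      by (simp_all add: cong_def)
  qed
  \<comment> \<open>Quantified over both square roots of \<open>-1\<close>: \<open>j\<close> serves for the numerator of the Cayley
    transform, \<open>- j\<close> for its denominator.\<close>
  obtain s :: 'a where s: "s = 1 \<or> s = -1"
      and jQ: "\<And>j'. j'\<^sup>2 = -1 \<Longrightarrow> j' ^ Q = s * j' \<and> j' ^ R = s * j' \<and> j' ^ S = s * e * j'"
  proof -
    from cong obtain t :: int where t: "t \<in> {1, -1}" "[int Q = t * 1] (mod 4)"
      "[int R = t * 1] (mod 4)" "[int S = t * (if e = 1 then 1 else -1)] (mod 4)"
      unfolding cong_upto_sign_mod4_def prod.case by blast
    show thesis
    proof (rule that[of "of_int t"])
      show "(of_int t :: 'a) = 1 \<or> (of_int t :: 'a) = -1"
        using t(1) by auto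
      fix j' :: 'a assume "j'\<^sup>2 = -1"
      note pow = sqrt_minus_1_power[OF this]
      show "j' ^ Q = of_int t * j' \<and> j' ^ R = of_int t * j' \<and> j' ^ S = of_int t * e * j'"
        using t e neg by (auto simp: mod4 pow)
    qed
  qed
  have s2: "s\<^sup>2 = 1" and e2: "e\<^sup>2 = 1" using s e by auto
  \<comment> \<open>By \<open>conj\<close> below, \<open>A\<close> is the numerator of \<open>g\<close> as a rational function on \<open>U\<close> with
    denominator \<open>B\<close>.\<close>
  define A where "A x = e * x ^ Q + e * x ^ R + x ^ S - x ^ Q * x ^ R * x ^ S" for x
  have tan: "(1 + j' * x) ^ ?N = - poly B x + s * e * j' * A x" if "j'\<^sup>2 = -1" for j' x
  proof -
    have "(1 + j' * x) ^ ?N =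
        (1 + s * j' * x ^ Q) * (1 + s * j' * x ^ R) * (1 + s * e * j' * x ^ S)"
      using jQ[OF that] by (simp add: power_add frobQ power_mult_distrib)
    then show ?thesis
      using tangent_addition3[OF that s2 e2] by (simp add: B A_def)
  qed
  have tanj: "(1 + j * x) ^ ?N = - poly B x + s * e * j * A x"
    "(1 - j * x) ^ ?N = - poly B x - s * e * j * A x" for x
    using tan[of j x] tan[of "-j" x] j by simp_all
  have conj: "x ^ ?N * poly B x ^ q = A x" if x: "x ^ (q + 1) = 1" for x
  proof -
    \<comment> \<open>Raising to the power \<open>q\<close> inverts each of \<open>x ^ Q\<close>, \<open>x ^ R\<close>, \<open>x ^ S\<close>.\<close>
    have inv: "(x ^ n) ^ q * x ^ n = 1" for n
      using x by (metis power_add power_mult power_one mult.commute power_one_right power_mult_distrib)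
    have eq: "e ^ q = e" using e odd by auto
    have "poly B x ^ q = (x ^ Q) ^ q * (x ^ R) ^ q + e * ((x ^ Q) ^ q * (x ^ S) ^ q)
        + e * ((x ^ R) ^ q * (x ^ S) ^ q) - 1"
      by (simp add: B frobq power_mult_distrib eq)
    moreover have "a * b * c * (a' * b' + e * (a' * c') + e * (b' * c') - 1) =
        e * a + e * b + c - a * b * c"
      if "a' * a = 1" "b' * b = 1" "c' * c = 1" for a b c a' b' c' :: 'a
      using that by algebra
    ultimately show ?thesis
      using inv by (simp only: A_def power_add)
  qed
  have nz: "poly B x \<noteq> 0" if "x ^ (q + 1) = 1" for x
  proof
    assume B0: "poly B x = 0"
    then have "A x = 0" using conj[OF that] q1 by (simp add: power_0_left)
    with B0 tanj[of x] N0 have "1 + j * x = 0" "1 - j * x = 0" by auto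
    then have "(1 + j * x) + (1 - j * x) = 0" by simp
    then show False using two by simp
  qed
  define g where "g u = u ^ r * poly B u ^ (q - 1)" for u
  have g: "poly B x * g x = A x" if x: "x ^ (q + 1) = 1" for x
  proof -
    have red: "x ^ n = x ^ (n mod (q + 1))" for n
      using power_add[of x "(q + 1) * (n div (q + 1))" "n mod (q + 1)"] x
      by (simp only: power_mult power_one mult_1 mult_div_mod_eq)
    have "x ^ r = x ^ ?N"
      using red[of r] red[of ?N] assms(10) by (simp add: cong_def)
    then have "poly B x * g x = x ^ ?N * (poly B x ^ (q - 1) * poly B x)"
      by (simp add: g_def)
    also have "poly B x ^ (q - 1) * poly B x = poly B x ^ q"
      using q1 by (intro power_minus_mult) simp
    finally show ?thesis
      using conj[OF x] by simp
  qed
  have inj_g: "inj_on g {x. x ^ (q + 1) = 1} \<longleftrightarrow> gcd ?N m = 1"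
    if m: "j ^ q = j \<and> m = q + 1 \<or> j ^ q = - j \<and> m = q - 1" for m
  proof (rule inj_on_cayley_power_iff[OF assms(1,2,4,5) q1 N0 j _ m,
        where i = "- (s * e * j)" and b = "\<lambda>x. - poly B x"])
    show "- (s * e * j) \<noteq> 0" using s e j by auto
    fix x :: 'a assume x: "x ^ (q + 1) = 1"
    show "- poly B x \<noteq> 0" using nz[OF x] by simp
    show "(1 + j * x) ^ ?N = - poly B x * (1 + - (s * e * j) * g x)"
      unfolding tanj g[OF x, symmetric] by (simp add: algebra_simps)
    show "(1 - j * x) ^ ?N = - poly B x * (1 - - (s * e * j) * g x)"
      unfolding tanj g[OF x, symmetric] by (simp add: algebra_simps)
  qed
  have "poly f = (\<lambda>x. x ^ r * poly B (x ^ (q - 1)))"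
    by (simp add: assms(12) fun_eq_iff poly_pcompose poly_monom)
  then have "permutes_field f \<longleftrightarrow> inj (\<lambda>x. x ^ r * poly B (x ^ (q - 1)))"
    unfolding permutes_field_def bij_def using finite_UNIV_inj_surj[OF finite] by metis
  also have "\<dots> \<longleftrightarrow> gcd r (q - 1) = 1 \<and> inj_on g {x. x ^ (q + 1) = 1}"
    unfolding g_def by (rule inj_power_times_power_iff[OF assms(1,4,5) q1 assms(9) nz])
  also have "inj_on g {x. x ^ (q + 1) = 1} \<longleftrightarrow>
      ([int q = 1] (mod 4) \<and> gcd ?N (q + 1) = 1) \<or> ([int q = -1] (mod 4) \<and> gcd ?N (q - 1) = 1)"
  proof -
    from odd have "q mod 4 = 1 \<or> q mod 4 = 3" by presburger
    then show ?thesis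
      using inj_g sqrt_minus_1_power[OF j, of q] by (auto simp: mod4)
  qed
  finally show ?thesis .
qed

end
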